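(* Let $N_0\ge1$, $N=N_0^2$, let $\theta_1,\dots,\theta_K$ be angles, and let $0<\lambda_1\le 1$ and $\lambda_2=1-\lambda_1$. Fix any $k\in\{1,\dots,K\}$, let $R_{\theta_k}:\mathbb R^N\to\mathbb R^{N_0}$ be the discrete Radon integration operator along angle $\theta_k$, with adjoint $R_{\theta_k}^*$, and let $$\tilde{\mathcal C}_k=\{(\gamma,\gamma_k)\in\Sigma_{N\times N}\times\Sigma_{N_0\times N_0}: R_{\theta_k}(\gamma\mathbf 1_N)=\gamma_k\mathbf 1_{N_0}\},$$ where $\Sigma_{n\times n}$ denotes the set of $n\times n$ matrices with nonnegative entries summing to $1$. Let $\bar{\boldsymbol\gamma}=(\bar\gamma,\bar\gamma_k)\in\mathbb R^{N\times N}\times\mathbb R^{N_0\times N_0}$ have strictly positive entries. Then the projection $\boldsymbol\gamma=(\gamma,\gamma_k)=\operatorname{argmin}_{\boldsymbol\gamma\in\tilde{\mathcal C}_k}\mathrm{KL}_\lambda(\boldsymbol\gamma|\bar{\boldsymbol\gamma})$ for the KL metric $$\mathrm{KL}_\lambda(\boldsymbol\gamma|\bar{\boldsymbol\gamma})=\lambda_1\mathrm{KL}(\gamma|\bar\gamma)+\lambda_2\mathrm{KL}(\gamma_k|\bar\gamma_k)$$ satisfies $$\gamma=\operatorname{diag}\!\left(R_{\theta_k}^*\!\left(\frac{\delta_k}{\alpha_k}\right)\right)\bar\gamma\quad\text{and}\quad \gamma_k=\operatorname{diag}\!\left(\frac{\delta_k}{\beta_k}\right)\bar\gamma_k,$$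 where $\alpha_k=R_{\theta_k}(\bar\gamma\mathbf 1_N)$, $\beta_k=\bar\gamma_k\mathbf 1_{N_0}$ and $\delta_k=\alpha_k^{\lambda_1}\odot\beta_k^{\lambda_2}$, with entry-wise product $\odot$, powers and quotients.
   Context: $\mathbf 1_n\in\mathbb R^n$ is the all-ones vector. For a nonnegative matrix $\gamma$ and a matrix $\xi$ of the same size with strictly positive entries, $\mathrm{KL}(\gamma|\xi)=\sum_{i,j}\gamma_{i,j}(\log(\gamma_{i,j}/\xi_{i,j})-1)$, with the convention $0\log0=0$. Discrete Radon operator: let $\omega_{N_0}=\{1,\dots,N_0\}$ and let $\Omega_N=\omega_{N_0}\times\omega_{N_0}$ be the grid of $N=N_0^2$ pixels, so that $\mathbb R^N\simeq\mathbb R^{\Omega_N}$ and $N\times N$ matrices are indexed by $\Omega_N\times\Omega_N$. For an angle $\theta$ and $(s_1,s_2)\in\Omega_N$ define the discrete line points $$\ell^\theta_{s_1,s_2}=\begin{cases}(s_2,\ s_1+[(s_2-1)\tan\theta]\bmod N_0) & \text{if }\theta\bmod\pi\in[0,\pi/4]\cup[3\pi/4,\pi],\\ (s_1+[(s_2-1)\cot\theta]\bmod N_0,\ s_2) & \text{if }\theta\bmod\pi\in[\pi/4,3\pi/4],\end{cases}$$ (the first case being used at the common endpoints), where $[x]$ denotes rounding to the nearest integer (with any fixed convention for ties), and $\bmod N_0$ is applied to the whole coordinate and takes the representative in $\{1,\dots,N_0\}$ (cyclic boundary conditions). For $f\in\mathbb R^N$, $R_\theta(f)\in\mathbb R^{N_0}$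 is given by $R_\theta(f)_{s_1}=\sum_{s_2=1}^{N_0}f_{\ell^\theta_{s_1,s_2}}$ for $s_1\in\omega_{N_0}$, and its adjoint is $R_\theta^*(r)=f$ with $f_{\ell^\theta_{s_1,s_2}}=r_{s_1}$ for all $(s_1,s_2)\in\Omega_N$.
   Formalization: False as stated: the formula has total mass Σδ_k, generally not 1. Proved: over C̃_k the minimizer is the formula divided by Σδ_k; without the "summing to 1" constraint it is the formula itself. If λ_2=0, γ_k need not be unique; the formula is then one minimizer. *)

theory Defs
  imports "HOL-Analysis.Analysis" "HOL-Library.Real_Mod"
begin

text \<open>
  Vectors and matrices over a finite index set \<open>I\<close> are functions \<open>'i \<Rightarrow> real\<close> and
  \<open>'i \<Rightarrow> 'i \<Rightarrow> real\<close> of which only the entries with indices in \<open>I\<close> are meaningful;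
  \<open>mat_eq I\<close> is the corresponding equality.
\<close>

definition mat_eq :: "'i set \<Rightarrow> ('i \<Rightarrow> 'i \<Rightarrow> real) \<Rightarrow> ('i \<Rightarrow> 'i \<Rightarrow> real) \<Rightarrow> bool" where
  "mat_eq I A B \<longleftrightarrow> (\<forall>i\<in>I. \<forall>j\<in>I. A i j = B i j)"

definition mat_vec :: "'i set \<Rightarrow> ('i \<Rightarrow> 'i \<Rightarrow> real) \<Rightarrow> ('i \<Rightarrow> real) \<Rightarrow> 'i \<Rightarrow> real" where
  "mat_vec I A v = (\<lambda>i. \<Sum>j\<in>I. A i j * v j)"

definition mat_mat :: "'i set \<Rightarrow> ('i \<Rightarrow> 'i \<Rightarrow> real) \<Rightarrow> ('i \<Rightarrow> 'i \<Rightarrow> real) \<Rightarrow> 'i \<Rightarrow> 'i \<Rightarrow> real" where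
  "mat_mat I A B = (\<lambda>i j. \<Sum>l\<in>I. A i l * B l j)"

definition diag_mat :: "('i \<Rightarrow> real) \<Rightarrow> 'i \<Rightarrow> 'i \<Rightarrow> real" where
  "diag_mat v = (\<lambda>i j. if i = j then v i else 0)"

definition scale_mat :: "real \<Rightarrow> ('i \<Rightarrow> 'i \<Rightarrow> real) \<Rightarrow> 'i \<Rightarrow> 'i \<Rightarrow> real" where
  "scale_mat c A = (\<lambda>i j. c * A i j)"

definition ones :: "'i \<Rightarrow> real" where
  "ones = (\<lambda>_. 1)"

definition nonneg_mats :: "'i set \<Rightarrow> ('i \<Rightarrow> 'i \<Rightarrow> real) set" where
  "nonneg_mats I = {A. \<forall>i\<in>I. \<forall>j\<in>I. 0 \<le> A i j}"

definition simplex_mats :: "'i set \<Rightarrow> ('i \<Rightarrow> 'i \<Rightarrow> real) set" where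
  "simplex_mats I = {A \<in> nonneg_mats I. (\<Sum>i\<in>I. \<Sum>j\<in>I. A i j) = 1}"

text \<open>The convention \<open>0 log 0 = 0\<close> needs no case distinction: the factor \<open>0\<close> annihilates \<open>ln 0\<close>.\<close>

definition KL :: "'i set \<Rightarrow> ('i \<Rightarrow> 'i \<Rightarrow> real) \<Rightarrow> ('i \<Rightarrow> 'i \<Rightarrow> real) \<Rightarrow> real" where
  "KL I g x = (\<Sum>i\<in>I. \<Sum>j\<in>I. g i j * (ln (g i j / x i j) - 1))"

type_synonym pixel = "nat \<times> nat"

definition omega :: "nat \<Rightarrow> nat set" where
  "omega N0 = {1..N0}"

definition Omega :: "nat \<Rightarrow> pixel set" where
  "Omega N0 = omega N0 \<times> omega N0"

definition wrap :: "nat \<Rightarrow> int \<Rightarrow> nat" where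
  "wrap N0 z = nat ((z - 1) mod int N0) + 1"

text \<open>
  The bound only leaves a choice at half-integers, where it allows either neighbour:
  quantifying over all such \<open>rnd\<close> covers every tie convention.
\<close>

definition nearest_int :: "(real \<Rightarrow> int) \<Rightarrow> bool" where
  "nearest_int rnd \<longleftrightarrow> (\<forall>x. \<bar>real_of_int (rnd x) - x\<bar> \<le> 1 / 2)"

definition line_pt :: "(real \<Rightarrow> int) \<Rightarrow> nat \<Rightarrow> real \<Rightarrow> nat \<times> nat \<Rightarrow> pixel" where
  "line_pt rnd N0 \<theta> = (\<lambda>(s1, s2).
     if \<theta> rmod pi \<in> {0..pi/4} \<union> {3*pi/4..pi}
     then (s2, wrap N0 (int s1 + rnd ((real s2 - 1) * tan \<theta>)))
     else (wrap N0 (int s1 + rnd ((real s2 - 1) * cot \<theta>)), s2))"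

definition radon :: "(real \<Rightarrow> int) \<Rightarrow> nat \<Rightarrow> real \<Rightarrow> (pixel \<Rightarrow> real) \<Rightarrow> nat \<Rightarrow> real" where
  "radon rnd N0 \<theta> f = (\<lambda>s1. \<Sum>s2\<in>omega N0. f (line_pt rnd N0 \<theta> (s1, s2)))"

text \<open>
  The line points are a permutation of the grid (\<open>line_pt_bij\<close> below), so inverting them gives the
  vector whose value at the line point \<open>(s1, s2)\<close> is \<open>r s1\<close> (\<open>radon_adj_line_pt\<close>).
\<close>

definition radon_adj :: "(real \<Rightarrow> int) \<Rightarrow> nat \<Rightarrow> real \<Rightarrow> (nat \<Rightarrow> real) \<Rightarrow> pixel \<Rightarrow> real" where
  "radon_adj rnd N0 \<theta> r = (\<lambda>p. r (fst (the_inv_into (Omega N0) (line_pt rnd N0 \<theta>) p)))"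

definition KL_lam ::
  "nat \<Rightarrow> real \<Rightarrow> real \<Rightarrow> (pixel \<Rightarrow> pixel \<Rightarrow> real) \<times> (nat \<Rightarrow> nat \<Rightarrow> real)
     \<Rightarrow> (pixel \<Rightarrow> pixel \<Rightarrow> real) \<times> (nat \<Rightarrow> nat \<Rightarrow> real) \<Rightarrow> real" where
  "KL_lam N0 l1 l2 = (\<lambda>(g, gk) (x, xk).
     l1 * KL (Omega N0) g x + l2 * KL (omega N0) gk xk)"

definition radon_coupled ::
  "(real \<Rightarrow> int) \<Rightarrow> nat \<Rightarrow> real \<Rightarrow> (pixel \<Rightarrow> pixel \<Rightarrow> real) set \<Rightarrow> (nat \<Rightarrow> nat \<Rightarrow> real) set
     \<Rightarrow> ((pixel \<Rightarrow> pixel \<Rightarrow> real) \<times> (nat \<Rightarrow> nat \<Rightarrow> real)) set" where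
  "radon_coupled rnd N0 \<theta> S T = {(g, gk). g \<in> S \<and> gk \<in> T \<and>
     (\<forall>s\<in>omega N0. radon rnd N0 \<theta> (mat_vec (Omega N0) g ones) s = mat_vec (omega N0) gk ones s)}"

definition C_tilde ::
  "(real \<Rightarrow> int) \<Rightarrow> nat \<Rightarrow> real \<Rightarrow> ((pixel \<Rightarrow> pixel \<Rightarrow> real) \<times> (nat \<Rightarrow> nat \<Rightarrow> real)) set" where
  "C_tilde rnd N0 \<theta> = radon_coupled rnd N0 \<theta> (simplex_mats (Omega N0)) (simplex_mats (omega N0))"

definition C_cone ::
  "(real \<Rightarrow> int) \<Rightarrow> nat \<Rightarrow> real \<Rightarrow> ((pixel \<Rightarrow> pixel \<Rightarrow> real) \<times> (nat \<Rightarrow> nat \<Rightarrow> real)) set" where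
  "C_cone rnd N0 \<theta> = radon_coupled rnd N0 \<theta> (nonneg_mats (Omega N0)) (nonneg_mats (omega N0))"

definition is_KL_projection ::
  "nat \<Rightarrow> real \<Rightarrow> real \<Rightarrow> (pixel \<Rightarrow> pixel \<Rightarrow> real) \<times> (nat \<Rightarrow> nat \<Rightarrow> real)
     \<Rightarrow> ((pixel \<Rightarrow> pixel \<Rightarrow> real) \<times> (nat \<Rightarrow> nat \<Rightarrow> real)) set
     \<Rightarrow> (pixel \<Rightarrow> pixel \<Rightarrow> real) \<times> (nat \<Rightarrow> nat \<Rightarrow> real) \<Rightarrow> bool" where
  "is_KL_projection N0 l1 l2 x C p \<longleftrightarrow> is_arg_min (\<lambda>q. KL_lam N0 l1 l2 q x) (\<lambda>q. q \<in> C) p"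

lemma finite_omega [simp]: "finite (omega N0)" and finite_Omega [simp]: "finite (Omega N0)"
  by (auto simp: omega_def Omega_def)

lemma wrap_in_omega:
  assumes "N0 \<ge> 1"
  shows "wrap N0 z \<in> omega N0"
proof -
  have "(z - 1) mod int N0 < int N0" using assms by simp
  then show ?thesis using assms unfolding wrap_def omega_def atLeastAtMost_iff by linarith
qed

lemma wrap_inj:
  assumes "N0 \<ge> 1" "a \<in> omega N0" "b \<in> omega N0" "wrap N0 (int a + z) = wrap N0 (int b + z)"
  shows "a = b"
proof -
  have "0 \<le> (int a + z - 1) mod int N0" "0 \<le> (int b + z - 1) mod int N0"
    using assms(1) by simp_all
  then have "(int a + z - 1) mod int N0 = (int b + z - 1) mod int N0"
    using assms(4) unfolding wrap_def by linarith
  then have "int N0 dvd (int a + z - 1) - (int b + z - 1)"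
    by (rule mod_eq_dvd_iff[THEN iffD1])
  then have dvd: "int N0 dvd int a - int b"
    by simp
  have "\<bar>int a - int b\<bar> < int N0"
    using assms(2,3) unfolding omega_def atLeastAtMost_iff by linarith
  with dvd have "int a - int b = 0"
    using zdvd_not_zless[of "\<bar>int a - int b\<bar>" "int N0"] by (cases "int a = int b") simp_all
  then show ?thesis by simp
qed

lemma line_pt_cases:
  obtains (rows) h where "line_pt rnd N0 \<theta> = (\<lambda>(s1, s2). (s2, wrap N0 (int s1 + h s2)))"
  | (cols) h where "line_pt rnd N0 \<theta> = (\<lambda>(s1, s2). (wrap N0 (int s1 + h s2), s2))"
proof (cases "\<theta> rmod pi \<in> {0..pi/4} \<union> {3*pi/4..pi}")
  case True
  show ?thesis
    by (rule rows[of "\<lambda>s2. rnd ((real s2 - 1) * tan \<theta>)"]) (simp only: line_pt_def True if_True)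
next
  case False
  show ?thesis
    by (rule cols[of "\<lambda>s2. rnd ((real s2 - 1) * cot \<theta>)"]) (simp only: line_pt_def False if_False)
qed

lemma line_pt_bij:
  assumes "N0 \<ge> 1"
  shows "bij_betw (line_pt rnd N0 \<theta>) (Omega N0) (Omega N0)"
proof -
  have "inj_on (line_pt rnd N0 \<theta>) (Omega N0) \<and> line_pt rnd N0 \<theta> ` Omega N0 \<subseteq> Omega N0"
  proof (cases rule: line_pt_cases[of rnd N0 \<theta>])
    case (rows h)
    then show ?thesis
      by (auto simp: inj_on_def Omega_def wrap_in_omega[OF assms] dest: wrap_inj[OF assms])
  next
    case (cols h)
    then show ?thesis
      by (auto simp: inj_on_def Omega_def wrap_in_omega[OF assms] dest: wrap_inj[OF assms])
  qed
  then show ?thesis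
    by (simp add: bij_betw_def endo_inj_surj)
qed

lemma radon_adj_line_pt:
  assumes "N0 \<ge> 1" "s1 \<in> omega N0" "s2 \<in> omega N0"
  shows "radon_adj rnd N0 \<theta> r (line_pt rnd N0 \<theta> (s1, s2)) = r s1"
  using line_pt_bij[OF assms(1), of rnd \<theta>] assms
  by (simp add: radon_adj_def the_inv_into_f_f bij_betw_def Omega_def)

lemma radon_adj_adjoint:
  assumes "N0 \<ge> 1"
  shows "(\<Sum>p\<in>Omega N0. radon_adj rnd N0 \<theta> r p * f p) = (\<Sum>s\<in>omega N0. r s * radon rnd N0 \<theta> f s)"
proof -
  have "(\<Sum>p\<in>Omega N0. radon_adj rnd N0 \<theta> r p * f p)
      = (\<Sum>q\<in>Omega N0. radon_adj rnd N0 \<theta> r (line_pt rnd N0 \<theta> q) * f (line_pt rnd N0 \<theta> q))"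
    by (rule sum.reindex_bij_betw[OF line_pt_bij[OF assms], symmetric])
  also have "\<dots> = (\<Sum>(s1, s2)\<in>Omega N0. r s1 * f (line_pt rnd N0 \<theta> (s1, s2)))"
    by (rule sum.cong) (auto simp: radon_adj_line_pt[OF assms] Omega_def)
  also have "\<dots> = (\<Sum>s1\<in>omega N0. \<Sum>s2\<in>omega N0. r s1 * f (line_pt rnd N0 \<theta> (s1, s2)))"
    by (simp add: Omega_def sum.cartesian_product)
  finally show ?thesis
    by (simp add: radon_def sum_distrib_left)
qed

lemma mat_mat_diag:
  assumes "finite I" "i \<in> I"
  shows "mat_mat I (diag_mat v) A i j = v i * A i j"
proof -
  have "mat_mat I (diag_mat v) A i j = (\<Sum>l\<in>I. if i = l then v i * A l j else 0)"
    unfolding mat_mat_def diag_mat_def by (rule sum.cong) auto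
  then show ?thesis using assms by simp
qed

text \<open>
  \<open>diag (R* (\<delta> / \<alpha>)) gbar\<close> has total mass \<open>\<Sum> \<delta>\<close>, whatever \<open>\<delta>\<close> is. With
  \<open>\<delta> = \<alpha> powr l1 * \<beta> powr l2\<close> this is in general not \<open>1\<close> (for \<open>N0 = 1\<close> and constant entries \<open>2\<close>
  it is \<open>2\<close>), so that matrix minimises the divergence over \<open>C_cone\<close>, and has to be divided by
  \<open>\<Sum> \<delta>\<close> to lie in \<open>C_tilde\<close>.
\<close>

lemma sum_scaled_kernel:
  assumes "N0 \<ge> 1"
    and "\<forall>s\<in>omega N0. radon rnd N0 \<theta> (mat_vec (Omega N0) gbar ones) s \<noteq> 0"
  shows "(\<Sum>i\<in>Omega N0. \<Sum>j\<in>Omega N0. mat_mat (Omega N0) (diag_mat (radon_adj rnd N0 \<theta>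
            (\<lambda>s. \<delta> s / radon rnd N0 \<theta> (mat_vec (Omega N0) gbar ones) s))) gbar i j)
         = (\<Sum>s\<in>omega N0. \<delta> s)" (is "?L = _")
proof -
  let ?\<alpha> = "radon rnd N0 \<theta> (mat_vec (Omega N0) gbar ones)"
  have "?L = (\<Sum>i\<in>Omega N0. radon_adj rnd N0 \<theta> (\<lambda>s. \<delta> s / ?\<alpha> s) i * mat_vec (Omega N0) gbar ones i)"
    by (rule sum.cong) (auto simp: mat_mat_diag mat_vec_def ones_def sum_distrib_left)
  also have "\<dots> = (\<Sum>s\<in>omega N0. \<delta> s / ?\<alpha> s * ?\<alpha> s)"
    by (rule radon_adj_adjoint[OF assms(1)])
  also have "\<dots> = (\<Sum>s\<in>omega N0. \<delta> s)"
    using assms(2) by (intro sum.cong) auto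
  finally show ?thesis .
qed

end

theory Submission
  imports Defs
begin

text \<open>
  If \<open>Y\<close> arises from the reference matrix \<open>X\<close> by scaling its rows with \<open>v\<close>, then
  \<open>KL (A | X) = D (A, Y) - |Y| + \<langle>ln v, A 1\<rangle>\<close>, where \<open>D \<ge> 0\<close> is the generalised relative entropy,
  vanishing only at \<open>A = Y\<close>. For \<open>v = R* (c \<delta> / \<alpha>)\<close> and \<open>v = c \<delta> / \<beta>\<close> the coupling constraint turns
  both linear terms into pairings with the same vector \<open>r = R (g 1) = gk 1\<close>, and since
  \<open>l1 ln (\<delta> / \<alpha>) + l2 ln (\<delta> / \<beta>) = 0\<close> what remains of them is \<open>ln c\<close> times the total mass.
  This is constant on the cone for \<open>c = 1\<close>, and on \<open>C_tilde\<close> for every \<open>c\<close>.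
\<close>

section \<open>Relative entropy and its relation to \<open>KL\<close>\<close>

definition rel_entropy :: "'i set \<Rightarrow> ('i \<Rightarrow> 'i \<Rightarrow> real) \<Rightarrow> ('i \<Rightarrow> 'i \<Rightarrow> real) \<Rightarrow> real" where
  "rel_entropy I A Y = (\<Sum>i\<in>I. \<Sum>j\<in>I. A i j * ln (A i j / Y i j) - A i j + Y i j)"

text \<open>For \<open>a > 0\<close> this is \<open>ln t <= t - 1\<close>, with equality only at
  \<open>t = 1\<close>, taken at \<open>t = y / a\<close> and multiplied by \<open>a\<close>. For
  \<open>a = 0\<close> the expression is just \<open>y > 0\<close>.\<close>

lemma rel_entropy_term:
  fixes a y :: real
  assumes "0 \<le> a" "0 < y"
  shows "0 \<le> a * ln (a / y) - a + y"
    and "a * ln (a / y) - a + y = 0 \<longleftrightarrow> a = y"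
proof -
  consider "a = 0" | "0 < a" "a \<noteq> y" | "a = y" using assms by linarith
  then have "0 \<le> a * ln (a / y) - a + y \<and> (a * ln (a / y) - a + y = 0 \<longleftrightarrow> a = y)"
  proof cases
    case 2
    then have "y / a \<noteq> 1" "0 < y / a" using assms by auto
    then have "ln (y / a) < y / a - 1"
      using ln_le_minus_one[of "y / a"] ln_eq_minus_one[of "y / a"] by linarith
    then have "a * ln (y / a) < a * (y / a - 1)"
      using 2 by (intro mult_strict_left_mono)
    moreover have "ln (y / a) = - ln (a / y)"
      using 2 assms by (simp add: ln_div)
    ultimately have "0 < a * ln (a / y) - a + y"
      using 2 by (simp add: algebra_simps)
    then show ?thesis using 2 by simp
  qed (use assms in auto)
  then show "0 \<le> a * ln (a / y) - a + y"
    and "a * ln (a / y) - a + y = 0 \<longleftrightarrow> a = y" by auto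
qed

lemma rel_entropy_nonneg:
  assumes "A \<in> nonneg_mats I" "\<forall>i\<in>I. \<forall>j\<in>I. 0 < Y i j"
  shows "0 \<le> rel_entropy I A Y"
  unfolding rel_entropy_def using assms
  by (intro sum_nonneg rel_entropy_term(1)) (auto simp: nonneg_mats_def)

lemma rel_entropy_eq_0_iff:
  assumes "finite I" "A \<in> nonneg_mats I" "\<forall>i\<in>I. \<forall>j\<in>I. 0 < Y i j"
  shows "rel_entropy I A Y = 0 \<longleftrightarrow> mat_eq I A Y"
proof -
  let ?t = "\<lambda>i j. A i j * ln (A i j / Y i j) - A i j + Y i j"
  have t: "0 \<le> ?t i j" "?t i j = 0 \<longleftrightarrow> A i j = Y i j" if "i \<in> I" "j \<in> I" for i j
    using rel_entropy_term[of "A i j" "Y i j"] assms(2,3) that by (auto simp: nonneg_mats_def)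
  have "rel_entropy I A Y = 0 \<longleftrightarrow> (\<forall>i\<in>I. (\<Sum>j\<in>I. ?t i j) = 0)"
    unfolding rel_entropy_def using assms(1) t(1) by (intro sum_nonneg_eq_0_iff sum_nonneg) auto
  also have "\<dots> \<longleftrightarrow> (\<forall>i\<in>I. \<forall>j\<in>I. ?t i j = 0)"
    using assms(1) t(1) by (intro ball_cong refl sum_nonneg_eq_0_iff) auto
  also have "\<dots> \<longleftrightarrow> mat_eq I A Y"
    using t(2) by (simp add: mat_eq_def)
  finally show ?thesis .
qed

lemma KL_row_scaling:
  assumes "A \<in> nonneg_mats I" "\<forall>i\<in>I. \<forall>j\<in>I. 0 < X i j" "\<forall>i\<in>I. 0 < v i"
    and "\<forall>i\<in>I. \<forall>j\<in>I. Y i j = v i * X i j"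
  shows "KL I A X = rel_entropy I A Y - (\<Sum>i\<in>I. \<Sum>j\<in>I. Y i j)
           + (\<Sum>i\<in>I. ln (v i) * mat_vec I A ones i)"
proof -
  \<comment> \<open>Where \<open>A i j > 0\<close> this is
    \<open>ln (A / X) = ln (A / Y) + ln v\<close>, with \<open>Y\<close> added and subtracted to
    complete the entropy term. A zero entry is treated apart because the quotient rule for
    \<open>ln\<close> needs positive arguments; both sides then vanish.\<close>
  have "A i j * (ln (A i j / X i j) - 1)
      = (A i j * ln (A i j / Y i j) - A i j + Y i j) - Y i j + ln (v i) * A i j"
    if "i \<in> I" "j \<in> I" for i j
  proof (cases "A i j = 0")
    case False
    then have "0 < A i j" "0 < X i j" "0 < v i" "Y i j = v i * X i j"
      using assms that by (auto simp: nonneg_mats_def less_le)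
    then show ?thesis
      by (simp add: ln_div ln_mult algebra_simps)
  qed simp
  then have "KL I A X = (\<Sum>i\<in>I. \<Sum>j\<in>I.
      (A i j * ln (A i j / Y i j) - A i j + Y i j) - Y i j + ln (v i) * A i j)"
    unfolding KL_def by (intro sum.cong refl) auto
  also have "\<dots> = rel_entropy I A Y - (\<Sum>i\<in>I. \<Sum>j\<in>I. Y i j)
      + (\<Sum>i\<in>I. \<Sum>j\<in>I. ln (v i) * A i j)"
    by (simp only: rel_entropy_def sum.distrib sum_subtractf)
  finally show ?thesis
    by (simp add: mat_vec_def ones_def sum_distrib_left)
qed

text \<open>On \<open>C\<close> the objective exceeds \<open>B\<close> by two nonnegative entropies,
  both zero at \<open>(Y, Yk)\<close>, so a minimiser must make each weighted entropy vanish. With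
  \<open>l2 = 0\<close> the objective does not see \<open>gk\<close>, hence uniqueness of the second
  component only for \<open>0 < l2\<close>.\<close>

lemma KL_projection_by_rel_entropy:
  assumes l: "0 < l1" "0 \<le> l2"
    and C: "C \<subseteq> nonneg_mats (Omega N0) \<times> nonneg_mats (omega N0)"
    and Y: "(Y, Yk) \<in> C" "\<forall>i\<in>Omega N0. \<forall>j\<in>Omega N0. 0 < Y i j"
      "\<forall>i\<in>omega N0. \<forall>j\<in>omega N0. 0 < Yk i j"
    and KL: "\<And>g gk. (g, gk) \<in> C \<Longrightarrow> KL_lam N0 l1 l2 (g, gk) x
      = l1 * rel_entropy (Omega N0) g Y + l2 * rel_entropy (omega N0) gk Yk + B"
  shows "is_KL_projection N0 l1 l2 x C (Y, Yk)
    \<and> (\<forall>g gk. is_KL_projection N0 l1 l2 x C (g, gk)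
        \<longrightarrow> mat_eq (Omega N0) g Y \<and> (0 < l2 \<longrightarrow> mat_eq (omega N0) gk Yk))"
proof (intro conjI allI impI)
  have D: "0 \<le> l1 * rel_entropy (Omega N0) g Y" "0 \<le> l2 * rel_entropy (omega N0) gk Yk"
    "rel_entropy (Omega N0) g Y = 0 \<longleftrightarrow> mat_eq (Omega N0) g Y"
    "rel_entropy (omega N0) gk Yk = 0 \<longleftrightarrow> mat_eq (omega N0) gk Yk"
    if "(g, gk) \<in> C" for g gk
    using that C Y(2,3) l
      rel_entropy_eq_0_iff[of "Omega N0" g Y] rel_entropy_eq_0_iff[of "omega N0" gk Yk]
    by (auto intro!: mult_nonneg_nonneg rel_entropy_nonneg simp del: zero_le_mult_iff)
  have min: "KL_lam N0 l1 l2 (Y, Yk) x = B"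
    using KL[OF Y(1)] D(3,4)[OF Y(1)] by (simp add: mat_eq_def)
  show "is_KL_projection N0 l1 l2 x C (Y, Yk)"
    unfolding is_KL_projection_def is_arg_min_def
  proof (intro conjI notI)
    show "(Y, Yk) \<in> C" by (fact Y(1))
    assume "\<exists>q. q \<in> C \<and> KL_lam N0 l1 l2 q x < KL_lam N0 l1 l2 (Y, Yk) x"
    then obtain g gk where "(g, gk) \<in> C" "KL_lam N0 l1 l2 (g, gk) x < B"
      using min by auto
    then show False
      using KL[of g gk] D(1,2)[of g gk] by linarith
  qed
  fix g gk
  assume "is_KL_projection N0 l1 l2 x C (g, gk)"
  then have gC: "(g, gk) \<in> C" and "KL_lam N0 l1 l2 (g, gk) x \<le> B"
    using Y(1) min by (auto simp: is_KL_projection_def is_arg_min_def not_less)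
  \<comment> \<open>Two nonnegative numbers whose sum is at most 0.\<close>
  then have "l1 * rel_entropy (Omega N0) g Y = 0" "l2 * rel_entropy (omega N0) gk Yk = 0"
    using KL[OF gC] D(1,2)[OF gC] by linarith+
  then show "mat_eq (Omega N0) g Y" "0 < l2 \<Longrightarrow> mat_eq (omega N0) gk Yk"
    using D(3,4)[OF gC] l by auto
qed

section \<open>The Radon operator, its adjoint and row scalings\<close>

lemma line_pt_in_Omega:
  assumes "N0 \<ge> 1" "s1 \<in> omega N0" "s2 \<in> omega N0"
  shows "line_pt rnd N0 \<theta> (s1, s2) \<in> Omega N0"
  using bij_betw_apply[OF line_pt_bij[OF assms(1)]] assms by (simp add: Omega_def)

text \<open>The adjoint maps the constant 1 to the constant 1, so this is adjointness tested against
  ones.\<close>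

lemma radon_mass:
  assumes "N0 \<ge> 1"
  shows "(\<Sum>s\<in>omega N0. radon rnd N0 \<theta> f s) = (\<Sum>p\<in>Omega N0. f p)"
  using radon_adj_adjoint[OF assms, of rnd \<theta> "\<lambda>_. 1" f] by (simp add: radon_adj_def)

text \<open>The line points exhaust the grid, so each value of the adjoint is an entry of
  \<open>r\<close>.\<close>

lemma radon_adj_pos:
  assumes "N0 \<ge> 1" "\<forall>s\<in>omega N0. 0 < r s" "p \<in> Omega N0"
  shows "0 < radon_adj rnd N0 \<theta> r p"
proof -
  have "p \<in> line_pt rnd N0 \<theta> ` Omega N0"
    using bij_betw_imp_surj_on[OF line_pt_bij[OF assms(1)]] assms(3) by simp
  then obtain s1 s2 where "s1 \<in> omega N0" "s2 \<in> omega N0" "p = line_pt rnd N0 \<theta> (s1, s2)"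
    by (auto simp: Omega_def)
  then show ?thesis
    using radon_adj_line_pt[OF assms(1)] assms(2) by simp
qed

text \<open>Along the line of index \<open>s\<close> the vector
  \<open>radon_adj rnd N0 \<theta> r\<close> is constantly \<open>r s\<close>, which factors out of
  the line sum.\<close>

lemma radon_radon_adj_mult:
  assumes "N0 \<ge> 1" "s \<in> omega N0" "\<forall>p\<in>Omega N0. f p = radon_adj rnd N0 \<theta> r p * h p"
  shows "radon rnd N0 \<theta> f s = r s * radon rnd N0 \<theta> h s"
  using assms radon_adj_line_pt[OF assms(1,2)] line_pt_in_Omega[OF assms(1,2)]
  by (simp add: radon_def sum_distrib_left)

lemma mat_vec_ones_pos:
  assumes "finite I" "i \<in> I" "\<forall>j\<in>I. 0 < A i j"
  shows "0 < mat_vec I A ones i"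
  unfolding mat_vec_def ones_def using assms by (intro sum_pos) auto

lemma mat_vec_row_scaling:
  assumes "i \<in> I" "\<forall>i\<in>I. \<forall>j\<in>I. Y i j = v i * X i j"
  shows "mat_vec I Y ones i = v i * mat_vec I X ones i"
  using assms by (simp add: mat_vec_def ones_def sum_distrib_left)

lemma mass_eq_mat_vec: "(\<Sum>i\<in>I. \<Sum>j\<in>I. A i j) = (\<Sum>i\<in>I. mat_vec I A ones i)"
  by (simp add: mat_vec_def ones_def)

text \<open>For \<open>l2 = 0\<close> the factor \<open>\<beta> powr 0\<close> is \<open>1\<close> only because \<open>\<beta>\<close> is nonzero.\<close>

lemma ln_weighted_geometric_mean:
  fixes a b c :: real
  assumes "0 < a" "0 < b" "0 < c" "l1 + l2 = 1"
  defines "d \<equiv> a powr l1 * b powr l2"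
  shows "l1 * ln (c * d / a) + l2 * ln (c * d / b) = ln c"
proof -
  have d: "0 < d" "ln d = l1 * ln a + l2 * ln b"
    using assms by (simp_all add: ln_mult ln_powr)
  have "l1 * ln (c * d / a) + l2 * ln (c * d / b)
      = (l1 + l2) * (ln c + ln d) - (l1 * ln a + l2 * ln b)"
    using assms(1-3) d(1) by (simp add: ln_div ln_mult algebra_simps)
  then show ?thesis
    using assms(4) d(2) by simp
qed

text \<open>The free factor \<open>c\<close> lets one computation serve both constraint sets:
  \<open>c = 1\<close> for the cone, \<open>c = 1 / m\<close> for unit mass. The pair is feasible
  because the row scalings turn both \<open>\<alpha>\<close> and \<open>\<beta>\<close> into the
  common marginal \<open>c * \<delta>\<close>.\<close>

lemma coupled_scaling:
  fixes rnd :: "real \<Rightarrow> int" and \<theta> :: real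
    and gbar :: "pixel \<Rightarrow> pixel \<Rightarrow> real" and gbark :: "nat \<Rightarrow> nat \<Rightarrow> real"
  assumes N0: "N0 \<ge> 1"
    and l: "l1 + l2 = 1"
    and gbar: "\<forall>i\<in>Omega N0. \<forall>j\<in>Omega N0. 0 < gbar i j"
    and gbark: "\<forall>i\<in>omega N0. \<forall>j\<in>omega N0. 0 < gbark i j"
    and c: "0 < c"
    and \<alpha>_def: "\<alpha> = radon rnd N0 \<theta> (mat_vec (Omega N0) gbar ones)"
    and \<beta>_def: "\<beta> = mat_vec (omega N0) gbark ones"
    and \<delta>_def: "\<delta> = (\<lambda>s. \<alpha> s powr l1 * \<beta> s powr l2)"
  defines "Y \<equiv> scale_mat c
      (mat_mat (Omega N0) (diag_mat (radon_adj rnd N0 \<theta> (\<lambda>s. \<delta> s / \<alpha> s))) gbar)"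
    and "Yk \<equiv> scale_mat c (mat_mat (omega N0) (diag_mat (\<lambda>s. \<delta> s / \<beta> s)) gbark)"
  shows "\<forall>s\<in>omega N0. 0 < \<delta> s" (is ?\<delta>_pos)
    and "\<forall>i\<in>Omega N0. \<forall>j\<in>Omega N0. 0 < Y i j" (is ?Y_pos)
    and "\<forall>i\<in>omega N0. \<forall>j\<in>omega N0. 0 < Yk i j" (is ?Yk_pos)
    and "(\<Sum>i\<in>Omega N0. \<Sum>j\<in>Omega N0. Y i j) = c * (\<Sum>s\<in>omega N0. \<delta> s)" (is ?Y_mass)
    and "(\<Sum>i\<in>omega N0. \<Sum>j\<in>omega N0. Yk i j) = c * (\<Sum>s\<in>omega N0. \<delta> s)" (is ?Yk_mass)
    and "(Y, Yk) \<in> C_cone rnd N0 \<theta>"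
    and "\<And>g gk. (g, gk) \<in> C_cone rnd N0 \<theta> \<Longrightarrow> KL_lam N0 l1 l2 (g, gk) (gbar, gbark)
      = l1 * rel_entropy (Omega N0) g Y + l2 * rel_entropy (omega N0) gk Yk
        + (ln c * (\<Sum>i\<in>omega N0. \<Sum>j\<in>omega N0. gk i j) - c * (\<Sum>s\<in>omega N0. \<delta> s))"
proof -
  define u where "u = (\<lambda>s. c * \<delta> s / \<alpha> s)"
  define w where "w = (\<lambda>s. c * \<delta> s / \<beta> s)"
  have \<alpha>: "0 < \<alpha> s" and \<beta>: "0 < \<beta> s" if s: "s \<in> omega N0" for s
  proof -
    have "omega N0 \<noteq> {}" using s by blast
    then show "0 < \<alpha> s"
      unfolding \<alpha>_def radon_def using line_pt_in_Omega[OF N0 s] gbar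
      by (intro sum_pos mat_vec_ones_pos) auto
    show "0 < \<beta> s"
      unfolding \<beta>_def using gbark s by (intro mat_vec_ones_pos) auto
  qed
  show \<delta>: ?\<delta>_pos
    using \<alpha> \<beta> by (force simp: \<delta>_def)
  have u: "\<forall>s\<in>omega N0. 0 < u s" and w: "\<forall>s\<in>omega N0. 0 < w s"
    using \<alpha> \<beta> \<delta> c by (auto simp: u_def w_def)
  \<comment> \<open>\<open>radon_adj\<close> only reindexes its argument, so the factor
    \<open>c\<close> moves inside it and is absorbed into \<open>u\<close>.\<close>
  have Y: "\<forall>i\<in>Omega N0. \<forall>j\<in>Omega N0. Y i j = radon_adj rnd N0 \<theta> u i * gbar i j"
    by (simp add: Y_def scale_mat_def mat_mat_diag radon_adj_def u_def)
  have Yk: "\<forall>i\<in>omega N0. \<forall>j\<in>omega N0. Yk i j = w i * gbark i j"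
    by (simp add: Yk_def scale_mat_def mat_mat_diag w_def)
  have adj_pos: "\<forall>i\<in>Omega N0. 0 < radon_adj rnd N0 \<theta> u i"
    using radon_adj_pos[OF N0 u] by blast
  show Y_pos: ?Y_pos
    using Y adj_pos gbar by simp
  show Yk_pos: ?Yk_pos
    using Yk w gbark by simp
  have RY: "radon rnd N0 \<theta> (mat_vec (Omega N0) Y ones) s = c * \<delta> s" if s: "s \<in> omega N0" for s
  proof -
    have "radon rnd N0 \<theta> (mat_vec (Omega N0) Y ones) s = u s * \<alpha> s"
      unfolding \<alpha>_def using mat_vec_row_scaling[OF _ Y]
      by (intro radon_radon_adj_mult[OF N0 s]) auto
    then show ?thesis using \<alpha>[OF s] by (simp add: u_def)
  qed
  have RYk: "mat_vec (omega N0) Yk ones s = c * \<delta> s" if s: "s \<in> omega N0" for s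
    using mat_vec_row_scaling[OF s Yk] \<beta>[OF s] by (simp add: w_def \<beta>_def)
  show Y_mass: ?Y_mass
    using radon_mass[OF N0, of rnd \<theta> "mat_vec (Omega N0) Y ones"]
    by (simp add: mass_eq_mat_vec RY sum_distrib_left)
  show Yk_mass: ?Yk_mass
    unfolding mass_eq_mat_vec by (simp add: RYk sum_distrib_left)
  show "(Y, Yk) \<in> C_cone rnd N0 \<theta>"
    using Y_pos Yk_pos RY RYk
    by (auto simp: C_cone_def radon_coupled_def nonneg_mats_def less_imp_le)
  fix g :: "pixel \<Rightarrow> pixel \<Rightarrow> real" and gk :: "nat \<Rightarrow> nat \<Rightarrow> real"
  assume "(g, gk) \<in> C_cone rnd N0 \<theta>"
  then have g: "g \<in> nonneg_mats (Omega N0)" and gk: "gk \<in> nonneg_mats (omega N0)"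
    and R: "\<forall>s\<in>omega N0. radon rnd N0 \<theta> (mat_vec (Omega N0) g ones) s = mat_vec (omega N0) gk ones s"
    by (auto simp: C_cone_def radon_coupled_def)
  let ?r = "mat_vec (omega N0) gk ones"
  \<comment> \<open>Being a reindexing, \<open>radon_adj\<close> also commutes with
    \<open>ln\<close>. Adjointness then moves the pairing to \<open>omega N0\<close>, where the
    coupling \<open>R\<close> replaces the Radon transform of the row sums of \<open>g\<close> by
    \<open>?r\<close>.\<close>
  have "(\<Sum>i\<in>Omega N0. ln (radon_adj rnd N0 \<theta> u i) * mat_vec (Omega N0) g ones i)
      = (\<Sum>s\<in>omega N0. ln (u s) * ?r s)"
    using radon_adj_adjoint[OF N0, of rnd \<theta> "\<lambda>s. ln (u s)" "mat_vec (Omega N0) g ones"] R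
    by (simp add: radon_adj_def)
  then have "KL_lam N0 l1 l2 (g, gk) (gbar, gbark)
      = l1 * (rel_entropy (Omega N0) g Y - c * (\<Sum>s\<in>omega N0. \<delta> s) + (\<Sum>s\<in>omega N0. ln (u s) * ?r s))
        + l2 * (rel_entropy (omega N0) gk Yk - c * (\<Sum>s\<in>omega N0. \<delta> s) + (\<Sum>s\<in>omega N0. ln (w s) * ?r s))"
    using KL_row_scaling[OF g gbar adj_pos Y] KL_row_scaling[OF gk gbark w Yk]
    by (simp add: KL_lam_def Y_mass Yk_mass)
  also have "\<dots> = l1 * rel_entropy (Omega N0) g Y + l2 * rel_entropy (omega N0) gk Yk
      + ((\<Sum>s\<in>omega N0. (l1 * ln (u s) + l2 * ln (w s)) * ?r s)
         - (l1 + l2) * (c * (\<Sum>s\<in>omega N0. \<delta> s)))"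
    by (simp add: sum.distrib sum_distrib_left algebra_simps)
  \<comment> \<open>The choice of \<open>\<delta>\<close> as a weighted geometric mean makes the
    coefficient of \<open>?r s\<close> independent of \<open>s\<close>, so only the total mass of
    \<open>gk\<close> remains.\<close>
  also have "(\<Sum>s\<in>omega N0. (l1 * ln (u s) + l2 * ln (w s)) * ?r s)
      = (\<Sum>s\<in>omega N0. ln c * ?r s)"
    using ln_weighted_geometric_mean[OF \<alpha> \<beta> c l]
    by (intro sum.cong refl) (simp add: u_def w_def \<delta>_def)
  finally show "KL_lam N0 l1 l2 (g, gk) (gbar, gbark)
      = l1 * rel_entropy (Omega N0) g Y + l2 * rel_entropy (omega N0) gk Yk
        + (ln c * (\<Sum>i\<in>omega N0. \<Sum>j\<in>omega N0. gk i j) - c * (\<Sum>s\<in>omega N0. \<delta> s))"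
    by (simp add: l mass_eq_mat_vec sum_distrib_left)
qed

section \<open>Projections onto the unit-mass set and onto the cone\<close>

theorem proposition3:
  fixes N0 K k :: nat and \<theta> :: "nat \<Rightarrow> real" and rnd :: "real \<Rightarrow> int"
    and l1 l2 :: real
    and gbar :: "pixel \<Rightarrow> pixel \<Rightarrow> real" and gbark :: "nat \<Rightarrow> nat \<Rightarrow> real"
    and \<alpha> \<beta> \<delta> :: "nat \<Rightarrow> real"
    and G :: "pixel \<Rightarrow> pixel \<Rightarrow> real" and Gk :: "nat \<Rightarrow> nat \<Rightarrow> real"
    and m :: real
  assumes "N0 \<ge> 1"
    and "nearest_int rnd"
    and "k \<in> {1..K}"
    and "0 < l1" and "l1 \<le> 1" and "l2 = 1 - l1"
    and "\<forall>i\<in>Omega N0. \<forall>j\<in>Omega N0. 0 < gbar i j"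
    and "\<forall>i\<in>omega N0. \<forall>j\<in>omega N0. 0 < gbark i j"
    and "\<alpha> = radon rnd N0 (\<theta> k) (mat_vec (Omega N0) gbar ones)"
    and "\<beta> = mat_vec (omega N0) gbark ones"
    and "\<delta> = (\<lambda>s. \<alpha> s powr l1 * \<beta> s powr l2)"
    and "G = mat_mat (Omega N0) (diag_mat (radon_adj rnd N0 (\<theta> k) (\<lambda>s. \<delta> s / \<alpha> s))) gbar"
    and "Gk = mat_mat (omega N0) (diag_mat (\<lambda>s. \<delta> s / \<beta> s)) gbark"
    and "m = (\<Sum>s\<in>omega N0. \<delta> s)"
  shows "is_KL_projection N0 l1 l2 (gbar, gbark) (C_tilde rnd N0 (\<theta> k))
           (scale_mat (1 / m) G, scale_mat (1 / m) Gk)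
    \<and> (\<forall>g gk. is_KL_projection N0 l1 l2 (gbar, gbark) (C_tilde rnd N0 (\<theta> k)) (g, gk)
          \<longrightarrow> mat_eq (Omega N0) g (scale_mat (1 / m) G)
            \<and> (0 < l2 \<longrightarrow> mat_eq (omega N0) gk (scale_mat (1 / m) Gk)))
    \<and> is_KL_projection N0 l1 l2 (gbar, gbark) (C_cone rnd N0 (\<theta> k)) (G, Gk)
    \<and> (\<forall>g gk. is_KL_projection N0 l1 l2 (gbar, gbark) (C_cone rnd N0 (\<theta> k)) (g, gk)
          \<longrightarrow> mat_eq (Omega N0) g G
            \<and> (0 < l2 \<longrightarrow> mat_eq (omega N0) gk Gk))"
proof -
  have l: "0 < l1" "0 \<le> l2" "l1 + l2 = 1"
    using assms(4-6) by simp_all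
  \<comment> \<open>The premise \<open>0 < c\<close> stays open, so that \<open>c\<close> can be
    chosen separately for each of the two projections.\<close>
  note scaling = coupled_scaling[OF assms(1) l(3) assms(7,8) _ assms(9-11),
      folded assms(12-14)]
  have m: "0 < m"
    unfolding assms(14) using scaling(1)[of 1] assms(1)
    by (intro sum_pos) (auto simp: omega_def)
  have C_tilde: "(g, gk) \<in> C_tilde rnd N0 (\<theta> k) \<longleftrightarrow> (g, gk) \<in> C_cone rnd N0 (\<theta> k)
      \<and> (\<Sum>i\<in>Omega N0. \<Sum>j\<in>Omega N0. g i j) = 1 \<and> (\<Sum>i\<in>omega N0. \<Sum>j\<in>omega N0. gk i j) = 1"
    for g gk
    by (auto simp: C_tilde_def C_cone_def radon_coupled_def simplex_mats_def)
  have cone: "C_cone rnd N0 (\<theta> k) \<subseteq> nonneg_mats (Omega N0) \<times> nonneg_mats (omega N0)"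
    by (auto simp: C_cone_def radon_coupled_def)
  have "is_KL_projection N0 l1 l2 (gbar, gbark) (C_tilde rnd N0 (\<theta> k))
           (scale_mat (1 / m) G, scale_mat (1 / m) Gk)
    \<and> (\<forall>g gk. is_KL_projection N0 l1 l2 (gbar, gbark) (C_tilde rnd N0 (\<theta> k)) (g, gk)
          \<longrightarrow> mat_eq (Omega N0) g (scale_mat (1 / m) G)
            \<and> (0 < l2 \<longrightarrow> mat_eq (omega N0) gk (scale_mat (1 / m) Gk)))"
  \<comment> \<open>\<open>B\<close> is \<open>ln c * mass - c * m\<close> at
    \<open>c = 1 / m\<close>, where \<open>mass\<close>, the total of \<open>gk\<close>, is 1 on
    \<open>C_tilde\<close>.\<close>
  proof (rule KL_projection_by_rel_entropy[OF l(1,2), where B = "ln (1 / m) - 1"])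
    have c: "0 < 1 / m" using m by simp
    show "C_tilde rnd N0 (\<theta> k) \<subseteq> nonneg_mats (Omega N0) \<times> nonneg_mats (omega N0)"
      using cone C_tilde by auto
    show "(scale_mat (1 / m) G, scale_mat (1 / m) Gk) \<in> C_tilde rnd N0 (\<theta> k)"
      using scaling(4-6)[OF c] m by (simp add: C_tilde)
    show "\<forall>i\<in>Omega N0. \<forall>j\<in>Omega N0. 0 < scale_mat (1 / m) G i j"
      and "\<forall>i\<in>omega N0. \<forall>j\<in>omega N0. 0 < scale_mat (1 / m) Gk i j"
      using scaling(2,3)[OF c] by auto
    fix g gk
    assume "(g, gk) \<in> C_tilde rnd N0 (\<theta> k)"
    then show "KL_lam N0 l1 l2 (g, gk) (gbar, gbark)
        = l1 * rel_entropy (Omega N0) g (scale_mat (1 / m) G)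
          + l2 * rel_entropy (omega N0) gk (scale_mat (1 / m) Gk) + (ln (1 / m) - 1)"
      using scaling(7)[OF c] m by (simp add: C_tilde)
  qed
  moreover have "is_KL_projection N0 l1 l2 (gbar, gbark) (C_cone rnd N0 (\<theta> k)) (G, Gk)
    \<and> (\<forall>g gk. is_KL_projection N0 l1 l2 (gbar, gbark) (C_cone rnd N0 (\<theta> k)) (g, gk)
          \<longrightarrow> mat_eq (Omega N0) g G \<and> (0 < l2 \<longrightarrow> mat_eq (omega N0) gk Gk))"
  \<comment> \<open>At \<open>c = 1\<close> the term \<open>ln c\<close> removes the dependence on
    the mass of \<open>gk\<close>, which varies over the cone.\<close>
  proof (rule KL_projection_by_rel_entropy[OF l(1,2) cone, where B = "- m"])
    have one: "scale_mat 1 A = A" for A :: "'i \<Rightarrow> 'i \<Rightarrow> real"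
      by (simp add: scale_mat_def)
    note scaling1 = scaling[OF zero_less_one, unfolded one]
    show "(G, Gk) \<in> C_cone rnd N0 (\<theta> k)"
      and "\<forall>i\<in>Omega N0. \<forall>j\<in>Omega N0. 0 < G i j"
      and "\<forall>i\<in>omega N0. \<forall>j\<in>omega N0. 0 < Gk i j"
      using scaling1(2,3,6) by auto
    fix g gk
    assume "(g, gk) \<in> C_cone rnd N0 (\<theta> k)"
    then show "KL_lam N0 l1 l2 (g, gk) (gbar, gbark)
        = l1 * rel_entropy (Omega N0) g G + l2 * rel_entropy (omega N0) gk Gk + - m"
      using scaling1(7) by simp
  qed
  ultimately show ?thesis by blast
qed

end
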